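(* Let $p$ be a prime and let the group $(\mathbb{Z}/p)^\times$ act on the additive group $\mathbb{Z}/p$ by multiplication (so that the $p$-fold product $[(\mathbb{Z}/p)^\times]^p$ acts coordinatewise on $(\mathbb{Z}/p)^p$). Let $\Delta_p$ act on the $p$-fold products $[(\mathbb{Z}/p)^\times]^p$ and $(\mathbb{Z}/p)^p$ by permuting the coordinates. Then there exists an isomorphism of groups $$\operatorname{Pgr}(\mathbb{Z}/p^2)\cong \bigl( (\mathbb{Z}/p)^p\rtimes [(\mathbb{Z}/p)^\times]^p\bigr)\rtimes \Delta_p.$$
   Context: For an associative ring $R$ with identity, a polynomial $f\in R[x]$ is called a permutation polynomial if the induced evaluation function $R\to R$ is bijective. The polypermutation group $\operatorname{Pgr}(R)$ is the subgroup of the symmetric group of the set $R$ generated by all permutations of $R$ that are induced by polynomials in $R[x]$. $\Delta_n$ denotes the permutation group on $n$ letters. The notation $A\rtimes G$ means the semidirect product with $G$ acting on $A$; in the outer semidirect product, $\Delta_p$ acts on $(\mathbb{Z}/p)^p\rtimes [(\mathbb{Z}/p)^\times]^p$ by permuting the coordinates of both factors simultaneously. *)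

theory Defs
  imports "HOL-Algebra.Algebra" "HOL-Number_Theory.Number_Theory"
begin

text \<open>
  \<open>poly_fun R f\<close> is the function on \<open>R\<close> induced by a polynomial \<open>f\<close>, extended by \<open>undefined\<close>
  outside \<open>carrier R\<close> so that it can be an element of \<open>BijGroup (carrier R)\<close>. Coefficients stand
  to the left of the powers of the argument, which matters only for non-commutative \<open>R\<close>.
\<close>

definition poly_fun :: "('a, 'm) ring_scheme \<Rightarrow> (nat \<Rightarrow> 'a) \<Rightarrow> 'a \<Rightarrow> 'a"
  where "poly_fun R f = (\<lambda>x\<in>carrier R. eval R R id x f)"

definition permutation_polynomial :: "('a, 'm) ring_scheme \<Rightarrow> (nat \<Rightarrow> 'a) \<Rightarrow> bool"
  where "permutation_polynomial R f \<longleftrightarrow>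
    f \<in> carrier (UP R) \<and> bij_betw (poly_fun R f) (carrier R) (carrier R)"

definition Pgr :: "('a, 'm) ring_scheme \<Rightarrow> ('a \<Rightarrow> 'a) monoid"
  where "Pgr R = (BijGroup (carrier R))
    \<lparr>carrier := generate (BijGroup (carrier R)) {poly_fun R f | f. permutation_polynomial R f}\<rparr>"

definition semidirect_product ::
  "('a, 'm) monoid_scheme \<Rightarrow> ('b, 'n) monoid_scheme \<Rightarrow> ('b \<Rightarrow> 'a \<Rightarrow> 'a) \<Rightarrow> ('a \<times> 'b) monoid"
  where "semidirect_product A G \<theta> =
    \<lparr>carrier = carrier A \<times> carrier G,
     monoid.mult = (\<lambda>(a, g) (b, h). (a \<otimes>\<^bsub>A\<^esub> \<theta> g b, g \<otimes>\<^bsub>G\<^esub> h)),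
     one = (\<one>\<^bsub>A\<^esub>, \<one>\<^bsub>G\<^esub>)\<rparr>"

abbreviation add_power :: "('a, 'm) ring_scheme \<Rightarrow> nat \<Rightarrow> (nat \<Rightarrow> 'a) monoid"
  where "add_power R n \<equiv> product_group {1..n} (\<lambda>_. add_monoid R)"

abbreviation units_power :: "('a, 'm) ring_scheme \<Rightarrow> nat \<Rightarrow> (nat \<Rightarrow> 'a) monoid"
  where "units_power R n \<equiv> product_group {1..n} (\<lambda>_. units_of R)"

definition units_action :: "('a, 'm) ring_scheme \<Rightarrow> nat \<Rightarrow> (nat \<Rightarrow> 'a) \<Rightarrow> (nat \<Rightarrow> 'a) \<Rightarrow> nat \<Rightarrow> 'a"
  where "units_action R n u =
    (\<lambda>a\<in>carrier (add_power R n). \<lambda>i\<in>{1..n}. u i \<otimes>\<^bsub>R\<^esub> a i)"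

abbreviation affine_power :: "('a, 'm) ring_scheme \<Rightarrow> nat \<Rightarrow> ((nat \<Rightarrow> 'a) \<times> (nat \<Rightarrow> 'a)) monoid"
  where "affine_power R n \<equiv>
    semidirect_product (add_power R n) (units_power R n) (units_action R n)"

text \<open>
  The inverse permutation makes this a left action: the \<open>i\<close>-th coordinate of \<open>x\<close> is moved to
  position \<open>s i\<close>.
\<close>

definition permute_coords :: "nat \<Rightarrow> (nat \<Rightarrow> nat) \<Rightarrow> (nat \<Rightarrow> 'a) \<Rightarrow> nat \<Rightarrow> 'a"
  where "permute_coords n s x = (\<lambda>i\<in>{1..n}. x (inv_into UNIV s i))"

definition perm_action ::
  "('a, 'm) ring_scheme \<Rightarrow> nat \<Rightarrow> (nat \<Rightarrow> nat) \<Rightarrow>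
    (nat \<Rightarrow> 'a) \<times> (nat \<Rightarrow> 'a) \<Rightarrow> (nat \<Rightarrow> 'a) \<times> (nat \<Rightarrow> 'a)"
  where "perm_action R n s =
    (\<lambda>(a, u)\<in>carrier (affine_power R n). (permute_coords n s a, permute_coords n s u))"


text \<open>The constructions above are groups, and the two maps are actions by automorphisms.\<close>

lemma group_Pgr: "group (Pgr R)"
proof -
  interpret B: group "BijGroup (carrier R)" by (rule group_BijGroup)
  have "{poly_fun R f | f. permutation_polynomial R f} \<subseteq> carrier (BijGroup (carrier R))"
    by (auto simp: BijGroup_def Bij_def permutation_polynomial_def poly_fun_def)
  then show ?thesis
    unfolding Pgr_def by (intro B.subgroup_imp_group B.generate_is_subgroup)
qed

lemma AutoGroup_memD:
  assumes "f \<in> carrier (AutoGroup A)"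
  shows "f \<in> hom A A" "f \<in> Bij (carrier A)"
  using assms by (auto simp: AutoGroup_def auto_def)

lemma group_semidirect_product:
  assumes "group A" "group G" and \<theta>: "\<theta> \<in> hom G (AutoGroup A)"
  shows "group (semidirect_product A G \<theta>)"
proof -
  interpret A: group A by fact
  interpret G: group G by fact
  have aut: "\<theta> g \<in> carrier (AutoGroup A)" if "g \<in> carrier G" for g
    using \<theta> that by (auto simp: hom_def)
  have hom: "\<theta> g \<in> hom A A" if "g \<in> carrier G" for g
    using AutoGroup_memD(1)[OF aut[OF that]] .
  have closed: "\<theta> g a \<in> carrier A" if "g \<in> carrier G" "a \<in> carrier A" for g a
    using hom[OF that(1)] that(2) by (auto simp: hom_def)
  have mult: "\<theta> g (a \<otimes>\<^bsub>A\<^esub> b) = \<theta> g a \<otimes>\<^bsub>A\<^esub> \<theta> g b"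
    if "g \<in> carrier G" "a \<in> carrier A" "b \<in> carrier A" for g a b
    using hom[OF that(1)] that(2,3) by (auto simp: hom_def)
  have comp: "\<theta> (g \<otimes>\<^bsub>G\<^esub> h) a = \<theta> g (\<theta> h a)"
    if "g \<in> carrier G" "h \<in> carrier G" "a \<in> carrier A" for g h a
  proof -
    have "\<theta> (g \<otimes>\<^bsub>G\<^esub> h) = compose (carrier A) (\<theta> g) (\<theta> h)"
      using \<theta> that AutoGroup_memD(2)[OF aut]
      by (auto simp: hom_def AutoGroup_def BijGroup_def)
    then show ?thesis using that(3) by (simp add: compose_eq)
  qed
  have one: "\<theta> \<one>\<^bsub>G\<^esub> a = a" if "a \<in> carrier A" for a
  proof -
    have "\<theta> \<one>\<^bsub>G\<^esub> = \<one>\<^bsub>AutoGroup A\<^esub>"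
      by (rule hom_one[OF \<theta> G.is_group A.AutoGroup])
    then show ?thesis using that by (simp add: AutoGroup_def BijGroup_def)
  qed
  show ?thesis
  proof (rule groupI)
    fix x assume "x \<in> carrier (semidirect_product A G \<theta>)"
    then obtain a g where x: "x = (a, g)" "a \<in> carrier A" "g \<in> carrier G"
      by (auto simp: semidirect_product_def)
    have "\<theta> (inv\<^bsub>G\<^esub> g) (inv\<^bsub>A\<^esub> a) \<otimes>\<^bsub>A\<^esub> \<theta> (inv\<^bsub>G\<^esub> g) a = \<theta> (inv\<^bsub>G\<^esub> g) \<one>\<^bsub>A\<^esub>"
      using mult[of "inv\<^bsub>G\<^esub> g" "inv\<^bsub>A\<^esub> a" a] x by simp
    also have "\<dots> = \<one>\<^bsub>A\<^esub>"
      by (rule hom_one[OF hom A.is_group A.is_group]) (use x in simp)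
    finally show "\<exists>y\<in>carrier (semidirect_product A G \<theta>).
        y \<otimes>\<^bsub>semidirect_product A G \<theta>\<^esub> x = \<one>\<^bsub>semidirect_product A G \<theta>\<^esub>"
      using x by (intro bexI[of _ "(\<theta> (inv\<^bsub>G\<^esub> g) (inv\<^bsub>A\<^esub> a), inv\<^bsub>G\<^esub> g)"])
        (auto simp: semidirect_product_def closed)
  qed (auto simp: semidirect_product_def closed mult comp one A.m_assoc G.m_assoc)
qed

lemma hom_AutoGroupI:
  assumes "group G" "group A"
    and ext: "\<And>g. g \<in> carrier G \<Longrightarrow> \<theta> g \<in> extensional (carrier A)"
    and closed: "\<And>g a. g \<in> carrier G \<Longrightarrow> a \<in> carrier A \<Longrightarrow> \<theta> g a \<in> carrier A"
    and mult: "\<And>g a b. g \<in> carrier G \<Longrightarrow> a \<in> carrier A \<Longrightarrow> b \<in> carrier A \<Longrightarrow>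
      \<theta> g (a \<otimes>\<^bsub>A\<^esub> b) = \<theta> g a \<otimes>\<^bsub>A\<^esub> \<theta> g b"
    and one: "\<And>a. a \<in> carrier A \<Longrightarrow> \<theta> \<one>\<^bsub>G\<^esub> a = a"
    and comp: "\<And>g h a. g \<in> carrier G \<Longrightarrow> h \<in> carrier G \<Longrightarrow> a \<in> carrier A \<Longrightarrow>
      \<theta> (g \<otimes>\<^bsub>G\<^esub> h) a = \<theta> g (\<theta> h a)"
  shows "\<theta> \<in> hom G (AutoGroup A)"
proof -
  interpret G: group G by fact
  interpret A: group A by fact
  have bij: "bij_betw (\<theta> g) (carrier A) (carrier A)" if g: "g \<in> carrier G" for g
  proof (rule bij_betw_byWitness[where f' = "\<theta> (inv\<^bsub>G\<^esub> g)"])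
    show "\<forall>a\<in>carrier A. \<theta> (inv\<^bsub>G\<^esub> g) (\<theta> g a) = a"
      using g comp[of "inv\<^bsub>G\<^esub> g" g] one by simp
    show "\<forall>a\<in>carrier A. \<theta> g (\<theta> (inv\<^bsub>G\<^esub> g) a) = a"
      using g comp[of g "inv\<^bsub>G\<^esub> g"] one by simp
  qed (use closed g in auto)
  have Bij: "\<theta> g \<in> Bij (carrier A)" if "g \<in> carrier G" for g
    using ext bij that by (simp add: Bij_def)
  have auto: "\<theta> g \<in> carrier (AutoGroup A)" if "g \<in> carrier G" for g
    using Bij closed mult that by (simp add: AutoGroup_def auto_def hom_def)
  have "\<theta> (g \<otimes>\<^bsub>G\<^esub> h) = compose (carrier A) (\<theta> g) (\<theta> h)"
    if "g \<in> carrier G" "h \<in> carrier G" for g h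
    using ext comp that by (intro extensionalityI[where A = "carrier A"]) (auto simp: compose_eq)
  then show ?thesis
    using auto Bij by (auto simp: hom_def AutoGroup_def BijGroup_def)
qed

context ring
begin

lemma group_add_power: "group (add_power R n)"
  using a_group by (intro product_group) auto

lemma group_units_power: "group (units_power R n)"
  by (intro product_group units_group)

lemma units_action_hom: "units_action R n \<in> hom (units_power R n) (AutoGroup (add_power R n))"
proof -
  have mem: "u i \<in> carrier R \<and> u i \<in> Units R"
    if "u \<in> carrier (units_power R n)" "i \<in> {1..n}" for u i
    using that by (auto simp: PiE_def units_of_def Pi_def Units_def)
  have mem': "a i \<in> carrier R" if "a \<in> carrier (add_power R n)" "i \<in> {1..n}" for a i
    using that by (auto simp: PiE_def Pi_def)
  show ?thesis
  proof (rule hom_AutoGroupI[OF group_units_power group_add_power])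
    fix u a b assume u: "u \<in> carrier (units_power R n)"
      and a: "a \<in> carrier (add_power R n)" and b: "b \<in> carrier (add_power R n)"
    have "a \<otimes>\<^bsub>add_power R n\<^esub> b \<in> carrier (add_power R n)"
      using a b by (auto simp: PiE_def Pi_def)
    then show "units_action R n u (a \<otimes>\<^bsub>add_power R n\<^esub> b) =
        units_action R n u a \<otimes>\<^bsub>add_power R n\<^esub> units_action R n u b"
      using a b mem[OF u] mem'[OF a] mem'[OF b]
      by (auto simp: units_action_def fun_eq_iff r_distr simp del: carrier_product_group)
  next
    fix u v a assume u: "u \<in> carrier (units_power R n)" and v: "v \<in> carrier (units_power R n)"
      and a: "a \<in> carrier (add_power R n)"
    have "units_action R n v a \<in> carrier (add_power R n)"
      using a mem[OF v] mem'[OF a] by (auto simp: units_action_def)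
    then show "units_action R n (u \<otimes>\<^bsub>units_power R n\<^esub> v) a =
        units_action R n u (units_action R n v a)"
      using a mem[OF u] mem[OF v] mem'[OF a]
      by (auto simp: units_action_def units_of_def fun_eq_iff m_assoc
          simp del: carrier_product_group)
  next
    fix a assume a: "a \<in> carrier (add_power R n)"
    then show "units_action R n \<one>\<^bsub>units_power R n\<^esub> a = a"
      using mem'[OF a]
      by (auto simp: units_action_def units_of_def fun_eq_iff PiE_def extensional_def)
  next
    fix u a assume u: "u \<in> carrier (units_power R n)" and a: "a \<in> carrier (add_power R n)"
    show "units_action R n u a \<in> carrier (add_power R n)"
      using a mem[OF u] mem'[OF a] by (auto simp: units_action_def)
  qed (simp add: units_action_def)
qed

lemma group_affine_power: "group (affine_power R n)"
  by (intro group_semidirect_product group_add_power group_units_power units_action_hom)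

lemma perm_action_hom: "perm_action R n \<in> hom (sym_group n) (AutoGroup (affine_power R n))"
proof -
  have inv: "inv_into UNIV s i \<in> {1..n}" if "s permutes {1..n}" "i \<in> {1..n}" for s i
    using permutes_in_image[OF permutes_inv[OF that(1)]] that(2) by blast
  have pc: "permute_coords n s x \<in> ({1..n} \<rightarrow>\<^sub>E B)"
    if "s permutes {1..n}" "x \<in> ({1..n} \<rightarrow>\<^sub>E B)" for s x and B :: "'a set"
    using that inv[OF that(1)] by (auto simp: permute_coords_def PiE_def Pi_def)
  have carr: "carrier (affine_power R n) =
      ({1..n} \<rightarrow>\<^sub>E carrier R) \<times> ({1..n} \<rightarrow>\<^sub>E Units R)"
    by (simp add: semidirect_product_def units_of_def)
  have act: "perm_action R n s (a, u) = (permute_coords n s a, permute_coords n s u)"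
    if "(a, u) \<in> carrier (affine_power R n)" for s a u
    using that by (simp add: perm_action_def)
  have closed: "perm_action R n s x \<in> carrier (affine_power R n)"
    if s: "s permutes {1..n}" and x: "x \<in> carrier (affine_power R n)" for s x
  proof -
    obtain a u where xe: "x = (a, u)" by (cases x)
    have "a \<in> ({1..n} \<rightarrow>\<^sub>E carrier R)" "u \<in> ({1..n} \<rightarrow>\<^sub>E Units R)"
      using x unfolding xe carr by auto
    then show ?thesis
      using x pc[OF s] unfolding xe by (metis act carr mem_Sigma_iff)
  qed
  interpret F: group "affine_power R n" by (rule group_affine_power)
  show ?thesis
  proof (rule hom_AutoGroupI[OF sym_group_is_group group_affine_power])
    fix s assume "s \<in> carrier (sym_group n)"
    show "perm_action R n s \<in> extensional (carrier (affine_power R n))"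
      by (simp add: perm_action_def)
  next
    fix s x assume "s \<in> carrier (sym_group n)" "x \<in> carrier (affine_power R n)"
    then show "perm_action R n s x \<in> carrier (affine_power R n)"
      by (intro closed) (simp_all add: sym_group_carrier)
  next
    fix s x y assume "s \<in> carrier (sym_group n)"
      and x: "x \<in> carrier (affine_power R n)" and y: "y \<in> carrier (affine_power R n)"
    then have s: "s permutes {1..n}" by (simp add: sym_group_carrier)
    obtain a u where xe: "x = (a, u)" by (cases x)
    obtain b v where ye: "y = (b, v)" by (cases y)
    have a: "a \<in> ({1..n} \<rightarrow>\<^sub>E carrier R)" and u: "u \<in> ({1..n} \<rightarrow>\<^sub>E Units R)"
      using x unfolding xe carr by auto
    have b: "b \<in> ({1..n} \<rightarrow>\<^sub>E carrier R)" and v: "v \<in> ({1..n} \<rightarrow>\<^sub>E Units R)"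
      using y unfolding ye carr by auto
    have xy: "x \<otimes>\<^bsub>affine_power R n\<^esub> y =
        (\<lambda>i\<in>{1..n}. a i \<oplus> u i \<otimes> b i, \<lambda>i\<in>{1..n}. u i \<otimes> v i)"
      using b unfolding xe ye
      by (auto simp: semidirect_product_def units_action_def units_of_def fun_eq_iff)
    have e: "perm_action R n s x = (permute_coords n s a, permute_coords n s u)"
      "perm_action R n s y = (permute_coords n s b, permute_coords n s v)"
      using x y act unfolding xe ye by blast+
    have "perm_action R n s (x \<otimes>\<^bsub>affine_power R n\<^esub> y) =
        (permute_coords n s (\<lambda>i\<in>{1..n}. a i \<oplus> u i \<otimes> b i),
         permute_coords n s (\<lambda>i\<in>{1..n}. u i \<otimes> v i))"
      using F.m_closed[OF x y] act unfolding xy by blast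
    also have "\<dots> = perm_action R n s x \<otimes>\<^bsub>affine_power R n\<^esub> perm_action R n s y"
      using pc[OF s b] inv[OF s] unfolding e
      by (auto simp: semidirect_product_def units_action_def units_of_def fun_eq_iff
          permute_coords_def)
    finally show "perm_action R n s (x \<otimes>\<^bsub>affine_power R n\<^esub> y) =
        perm_action R n s x \<otimes>\<^bsub>affine_power R n\<^esub> perm_action R n s y" .
  next
    fix x assume x: "x \<in> carrier (affine_power R n)"
    obtain a u where xe: "x = (a, u)" by (cases x)
    have "a \<in> ({1..n} \<rightarrow>\<^sub>E carrier R)" "u \<in> ({1..n} \<rightarrow>\<^sub>E Units R)"
      using x unfolding xe carr by auto
    then have "permute_coords n id a = a" "permute_coords n id u = u"
      by (auto simp: permute_coords_def fun_eq_iff PiE_def extensional_def)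
    then show "perm_action R n \<one>\<^bsub>sym_group n\<^esub> x = x"
      using x act unfolding xe sym_group_one by metis
  next
    fix s t x assume "s \<in> carrier (sym_group n)" "t \<in> carrier (sym_group n)"
      and x: "x \<in> carrier (affine_power R n)"
    then have s: "s permutes {1..n}" and t: "t permutes {1..n}"
      by (simp_all add: sym_group_carrier)
    have comp: "inv_into UNIV (s \<circ> t) = inv_into UNIV t \<circ> inv_into UNIV s"
      using s t by (intro o_inv_distrib permutes_bij)
    have pcc: "permute_coords n (s \<circ> t) z = permute_coords n s (permute_coords n t z)"
      for z :: "nat \<Rightarrow> 'a"
      using inv[OF s] by (auto simp: permute_coords_def comp fun_eq_iff)
    obtain a u where xe: "x = (a, u)" by (cases x)
    show "perm_action R n (s \<otimes>\<^bsub>sym_group n\<^esub> t) x = perm_action R n s (perm_action R n t x)"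
      using x closed[OF t x] act unfolding xe sym_group_mult by (metis pcc)
  qed
qed

end

end

theory Submission
  imports Defs "HOL-Computational_Algebra.Polynomial"
begin

text \<open>
  Write a residue modulo \<open>p\<^sup>2\<close> as \<open>r + p t\<close> with \<open>r\<close>, \<open>t\<close> in \<open>{0..<p}\<close>. By Taylor expansion
  \<open>f (r + p t) = f r + p t f' r\<close>, so a polynomial function is given by the \<open>p\<close> affine functions
  \<open>t \<mapsto> f r + p t f' r\<close>. It is a permutation iff \<open>f\<close> permutes the residues modulo \<open>p\<close>
  and no \<open>f' r\<close> vanishes modulo \<open>p\<close>; then it permutes the residue classes modulo \<open>p\<close> and acts
  between them by invertible affine maps in \<open>t\<close>. Conversely all such data occur, because
  \<open>1 - (x - r) ^ (p (p - 1))\<close> is the indicator of the class of \<open>r\<close> modulo \<open>p\<close> by Euler's theorem,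
  so that polynomials can be prescribed on each class separately.
\<close>

section \<open>Polynomial functions on residue rings\<close>

context residues
begin

text \<open>Both \<open>deg R f\<close> and \<open>N\<close> bound the support of \<open>f\<close>,
  so the two sums agree with the one up to their maximum. Any convenient bound can thus replace the
  degree.\<close>

lemma eval_residue_ring:
  assumes f: "f \<in> carrier (UP R)" and x: "x \<in> carrier R"
    and N: "\<And>i. N < i \<Longrightarrow> f i = 0"
  shows "UnivPoly.eval R R id x f = (\<Sum>i\<le>N. f i * x ^ i) mod m"
proof -
  interpret UP_ring R "UP R"
    by unfold_locales
  have f_mem: "f i \<in> carrier R" for i
    using f by (auto simp: UP_def)
  have red: "y mod m = y" if "y \<in> carrier R" for y
    using that by (simp add: res_carrier_eq)
  have coeff: "UnivPoly.coeff (UP R) f i = f i" for i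
    using f by (simp only: UP_def up_ring.select_convs partial_object.select_convs restrict_apply')
  have pow: "x [^] i = x ^ i mod m" for i
    using pow_cong[of x i] red[OF x] by simp
  have mult: "f i \<otimes> x [^] i = (f i * x ^ i) mod m" for i
    using mult_cong[of "f i" "x ^ i"] red[OF f_mem, of i] unfolding pow by simp
  have zero: "f i = 0" if "deg R f < i" for i
    using deg_aboveD[OF that f] unfolding coeff res_zero_eq .
  have "UnivPoly.eval R R id x f = (\<Oplus>i\<in>{..deg R f}. f i \<otimes> x [^] i)"
    using f by (simp only: UnivPoly.eval_def restrict_apply' coeff id_apply)
  also have "\<dots> = (\<Sum>i\<le>deg R f. f i * x ^ i) mod m"
    unfolding mult by (rule sum_cong) simp
  also have "(\<Sum>i\<le>deg R f. f i * x ^ i) = (\<Sum>i\<le>max (deg R f) N. f i * x ^ i)"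
    by (rule sum.mono_neutral_left) (auto simp: zero)
  also have "\<dots> = (\<Sum>i\<le>N. f i * x ^ i)"
    by (rule sum.mono_neutral_right) (auto simp: N)
  finally show ?thesis .
qed

text \<open>Together with the converse \<open>poly_fun_residue_ringE\<close>, this trades
  \<open>UP R\<close> for \<open>int poly\<close>, where \<open>pderiv\<close> and integer
  congruences apply. Reducing the coefficients modulo \<open>m\<close> does not affect values modulo
  \<open>m\<close>.\<close>

lemma poly_fun_residue_ring_of_int_poly:
  obtains f where "f \<in> carrier (UP R)" "poly_fun R f = (\<lambda>x\<in>carrier R. poly q x mod m)"
proof
  let ?f = "\<lambda>i. Polynomial.coeff q i mod m"
  show f: "?f \<in> carrier (UP R)"
    by (auto simp: UP_def up_def bound_def res_zero_eq coeff_eq_0 intro!: exI[of _ "Polynomial.degree q"])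
  show "poly_fun R ?f = (\<lambda>x\<in>carrier R. poly q x mod m)"
    unfolding poly_fun_def
  proof (rule restrict_ext)
    fix x assume x: "x \<in> carrier R"
    have "UnivPoly.eval R R id x ?f = (\<Sum>i\<le>Polynomial.degree q. ?f i * x ^ i) mod m"
      using f x by (rule eval_residue_ring) (simp add: coeff_eq_0)
    also have "\<dots> = (\<Sum>i\<le>Polynomial.degree q. ?f i * x ^ i mod m) mod m"
      by (simp add: mod_sum_eq)
    also have "\<dots> = poly q x mod m"
      by (simp add: mod_mult_left_eq mod_sum_eq poly_altdef)
    finally show "UnivPoly.eval R R id x ?f = poly q x mod m" .
  qed
qed

lemma poly_fun_residue_ringE:
  assumes f: "f \<in> carrier (UP R)"
  obtains q :: "int poly" where "poly_fun R f = (\<lambda>x\<in>carrier R. poly q x mod m)"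
proof -
  from f obtain N where N: "f i = 0" if "N < i" for i
    by (auto simp: UP_def up_def bound_def res_zero_eq)
  have "poly_fun R f = (\<lambda>x\<in>carrier R. poly (\<Sum>i\<le>N. Polynomial.monom (f i) i) x mod m)"
    using eval_residue_ring[OF f _ N] unfolding poly_fun_def
    by (intro restrict_ext) (simp add: poly_sum poly_monom)
  then show thesis by (rule that)
qed

end

text \<open>The induction follows Horner's scheme: multiplying the expansion of \<open>q\<close> by
  \<open>r + n * t\<close> creates just one term of second order,
  \<open>n ^ 2 * (t ^ 2 * poly (pderiv q) r)\<close>, and the rest is the product rule.\<close>

lemma poly_add_mult_cong:
  fixes q :: "int poly"
  shows "[poly q (r + n * t) = poly q r + n * t * poly (pderiv q) r] (mod n ^ 2)"
proof (induction q)
  case (pCons c q)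
  have "[poly (pCons c q) (r + n * t) =
      c + (r + n * t) * (poly q r + n * t * poly (pderiv q) r)] (mod n ^ 2)"
    using pCons.IH by (simp add: cong_add cong_mult)
  also have "c + (r + n * t) * (poly q r + n * t * poly (pderiv q) r) =
      poly (pCons c q) r + n * t * poly (pderiv (pCons c q)) r
        + n ^ 2 * (t ^ 2 * poly (pderiv q) r)"
    by (simp add: pderiv_pCons algebra_simps power2_eq_square)
  also have "[\<dots> = poly (pCons c q) r + n * t * poly (pderiv (pCons c q)) r] (mod n ^ 2)"
    by (simp add: cong_def)
  finally show ?case .
qed simp

lemma affine_mod:
  fixes a u t n :: int
  shows "(a mod n + u mod n * t) mod n = (a + u * t) mod n"
  unfolding cong_def[symmetric] by (intro cong_add cong_mult cong_refl) (simp_all add: cong_def)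

text \<open>The affine map \<open>(b, v)\<close> after \<open>(a, u)\<close> is
  \<open>(b + v * a, v * u)\<close>, the multiplication of the inner semidirect product. The nested
  reductions on the right are those left by the operations of \<open>residue_ring\<close>.\<close>

lemma affine_comp_mod:
  fixes a b u v t n :: int
  shows "(b + v * ((a + u * t) mod n)) mod n = ((b + v * a mod n) mod n + v * u mod n * t) mod n"
proof -
  have "[v * ((a + u * t) mod n) = v * (a + u * t)] (mod n)" "[v * u mod n * t = v * u * t] (mod n)"
    by (intro cong_mult cong_refl; simp add: cong_def)+
  moreover have "[(b + v * a mod n) mod n = b + v * a] (mod n)"
    by (simp add: cong_def mod_add_right_eq)
  ultimately have "[b + v * ((a + u * t) mod n) = b + v * (a + u * t)] (mod n)"
    "[(b + v * a mod n) mod n + v * u mod n * t = b + v * a + v * u * t] (mod n)"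
    by (auto intro: cong_add)
  moreover have "b + v * (a + u * t) = b + v * a + v * u * t"
    by (simp add: distrib_left mult.assoc)
  ultimately show ?thesis
    unfolding cong_def by metis
qed

section \<open>Class-affine maps\<close>

text \<open>The class of \<open>r\<close> in \<open>{0..<p}\<close> carries the index \<open>r + 1\<close>.\<close>

definition residue_index :: "nat \<Rightarrow> int \<Rightarrow> nat"
  where "residue_index p x = Suc (nat (x mod int p))"

text \<open>The parameters \<open>a\<close>, \<open>u\<close> are indexed by the target class, to match \<open>permute_coords\<close>.\<close>

definition class_affine ::
  "nat \<Rightarrow> ((nat \<Rightarrow> int) \<times> (nat \<Rightarrow> int)) \<times> (nat \<Rightarrow> nat) \<Rightarrow> int \<Rightarrow> int"
  where "class_affine p = (\<lambda>((a, u), s). \<lambda>x\<in>{0..int (p ^ 2) - 1}.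
    let i = s (residue_index p x)
    in int i - 1 + int p * ((a i + u i * (x div int p)) mod int p))"

lemma class_affine_extensional: "class_affine p w \<in> extensional {0..int (p ^ 2) - 1}"
  by (simp add: class_affine_def split: prod.split)

context residues_prime
begin

section \<open>Base-\<open>p\<close> digits of residues modulo \<open>p ^ 2\<close>\<close>

lemma p_gt_one: "int p > 1"
  using p_prime prime_gt_1_nat by auto

lemma p_square_gt_one: "int (p ^ 2) > 1"
  using p_gt_one one_less_power[of p 2] by simp

lemma residue_index_mem: "residue_index p x \<in> {1..p}"
  using p_gt_one pos_mod_bound[of "int p" x] unfolding residue_index_def
  by (simp add: Suc_le_eq nat_less_iff)

lemma int_residue_index: "int (residue_index p x) = x mod int p + 1"
  using p_gt_one unfolding residue_index_def by simp

lemma residue_index_eq: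
  assumes "i \<in> {1..p}"
  shows "residue_index p (int i - 1 + int p * t) = i"
proof -
  have "int (residue_index p (int i - 1 + int p * t)) = int i"
    using assms unfolding int_residue_index by simp
  then show ?thesis by simp
qed

lemma digits_mem:
  assumes "i \<in> {1..p}" "t \<in> {0..<int p}"
  shows "int i - 1 + int p * t \<in> {0..int (p ^ 2) - 1}"
proof -
  have "int p * (t + 1) \<le> int p * int p" "0 \<le> int p * t"
    using assms by (auto intro: mult_left_mono)
  moreover have "1 \<le> int i" "int i \<le> int p"
    using assms by auto
  ultimately show ?thesis
    unfolding atLeastAtMost_iff of_nat_power of_nat_mult power2_eq_square distrib_left by linarith
qed

text \<open>Since \<open>int i - 1\<close> is a genuine low digit, division by \<open>p\<close>
  returns \<open>c\<close>; reducing modulo \<open>p * p\<close> keeps the low digit and reduces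
  \<open>c\<close> modulo \<open>p\<close>.\<close>

lemma mod_square_digits:
  assumes "i \<in> {1..p}"
  shows "(int i - 1 + int p * c) mod int (p ^ 2) = int i - 1 + int p * (c mod int p)"
proof -
  have "(int i - 1 + int p * c) div int p = c"
    using assms by simp
  moreover have "(int i - 1 + int p * c) mod int p = int i - 1"
    using assms by simp
  ultimately show ?thesis
    using zmod_zmult2_eq[of "int p" "int i - 1 + int p * c" "int p"]
    by (simp add: power2_eq_square)
qed

lemma div_mem:
  assumes "x \<in> {0..int (p ^ 2) - 1}"
  shows "x div int p \<in> {0..<int p}"
proof -
  have "x div int p * int p \<le> x"
    using div_mult_mod_eq[of x "int p"] p_gt_one pos_mod_sign[of "int p" x] by linarith
  also have "x < int p * int p"
    using assms by (simp add: power2_eq_square)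
  finally have "x div int p < int p"
    using p_gt_one by simp
  then show ?thesis
    using assms p_gt_one by (simp add: pos_imp_zdiv_nonneg_iff)
qed

lemma digits_eqI:
  assumes "residue_index p x = residue_index p y" "x div int p = y div int p"
  shows "x = y"
proof -
  have "x mod int p = y mod int p"
    using arg_cong[OF assms(1), of int] unfolding int_residue_index by simp
  then show ?thesis
    using assms(2) by (metis mult_div_mod_eq)
qed

text \<open>Up to regrouping tuples, \<open>affine_power R p\<close> is the \<open>p\<close>-th
  power of the affine group of the field with \<open>p\<close> elements, so this is its wreath
  product with the symmetric group on \<open>p\<close> letters.\<close>

abbreviation wreath :: "(((nat \<Rightarrow> int) \<times> (nat \<Rightarrow> int)) \<times> (nat \<Rightarrow> nat)) monoid"
  where "wreath \<equiv> semidirect_product (affine_power R p) (sym_group p) (perm_action R p)"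

lemma group_wreath: "group wreath"
  by (intro group_semidirect_product group_affine_power sym_group_is_group perm_action_hom)

lemma carrier_wreath: "carrier wreath =
    (({1..p} \<rightarrow>\<^sub>E {0..<int p}) \<times> ({1..p} \<rightarrow>\<^sub>E {1..<int p})) \<times> {s. s permutes {1..p}}"
proof -
  have "carrier R = {0..<int p}" "Units R = {1..<int p}"
    by (auto simp: res_carrier_eq res_prime_units_eq)
  then show ?thesis
    by (simp add: semidirect_product_def units_of_def sym_group_def)
qed

section \<open>Class-affine maps as a faithful image of the wreath product\<close>

context
  fixes a u s
  assumes mem: "((a, u), s) \<in> carrier wreath"
begin

lemma wreath_memD: "s permutes {1..p}" "i \<in> {1..p} \<Longrightarrow> a i \<in> {0..<int p}"
  "i \<in> {1..p} \<Longrightarrow> u i \<in> {1..<int p}"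
  using mem unfolding carrier_wreath by auto

lemma perm_residue_index_mem: "s (residue_index p x) \<in> {1..p}"
  using wreath_memD(1) residue_index_mem by (simp add: permutes_in_image del: atLeastAtMost_iff)

lemma residue_index_class_affine:
  assumes "x \<in> {0..int (p ^ 2) - 1}"
  shows "residue_index p (class_affine p ((a, u), s) x) = s (residue_index p x)"
  using assms residue_index_eq[OF perm_residue_index_mem]
  by (simp add: class_affine_def Let_def)

lemma class_affine_div:
  assumes "x \<in> {0..int (p ^ 2) - 1}"
  shows "class_affine p ((a, u), s) x div int p =
    (a (s (residue_index p x)) + u (s (residue_index p x)) * (x div int p)) mod int p"
  using assms perm_residue_index_mem[of x] by (simp add: class_affine_def Let_def)

lemma class_affine_mem:
  assumes "x \<in> {0..int (p ^ 2) - 1}"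
  shows "class_affine p ((a, u), s) x \<in> {0..int (p ^ 2) - 1}"
  using assms p_gt_one digits_mem[OF perm_residue_index_mem, of "_ mod int p"]
  by (simp add: class_affine_def Let_def)

text \<open>An image determines the class of its argument, as \<open>s\<close> is injective, and
  then the high digit, as the multiplier is a unit modulo \<open>p\<close>. An injective self-map of
  a finite set is bijective.\<close>

lemma class_affine_Bij: "class_affine p ((a, u), s) \<in> Bij {0..int (p ^ 2) - 1}"
proof -
  let ?S = "{0..int (p ^ 2) - 1}" and ?f = "class_affine p ((a, u), s)"
  have "inj_on ?f ?S"
  proof (rule inj_onI)
    fix x y assume x: "x \<in> ?S" and y: "y \<in> ?S" and eq: "?f x = ?f y"
    let ?i = "s (residue_index p x)"
    have "?i = s (residue_index p y)"
      using residue_index_class_affine x y eq by metis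
    then have idx: "residue_index p x = residue_index p y"
      using permutes_inj[OF wreath_memD(1)] by (simp add: inj_eq)
    have "[a ?i + u ?i * (x div int p) = a ?i + u ?i * (y div int p)] (mod int p)"
      using class_affine_div[OF x] class_affine_div[OF y] eq idx by (simp add: cong_def)
    then have "[u ?i * (x div int p) = u ?i * (y div int p)] (mod int p)"
      by (simp add: cong_add_lcancel)
    moreover have "coprime (u ?i) (int p)"
      using wreath_memD(3)[OF perm_residue_index_mem, of x]
      by (simp add: p_coprime_right_int zdvd_not_zless)
    ultimately have "[x div int p = y div int p] (mod int p)"
      using cong_mult_lcancel by blast
    then have "x div int p = y div int p"
      using div_mem[OF x] div_mem[OF y] by (simp add: cong_def)
    then show "x = y" by (rule digits_eqI[OF idx])
  qed
  moreover have "?f ` ?S \<subseteq> ?S" using class_affine_mem by blast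
  ultimately have "bij_betw ?f ?S ?S"
    by (simp add: bij_betw_def endo_inj_surj)
  then show ?thesis
    by (simp add: Bij_def class_affine_extensional del: of_nat_power)
qed

end

text \<open>The composite moves the class with index \<open>k\<close> to \<open>s (t k)\<close> by
  way of \<open>t k\<close>. Seen from the target \<open>i\<close>, the inner parameters are read at
  \<open>inv_into UNIV s i\<close>, which is the twist in \<open>permute_coords\<close>;
  \<open>affine_comp_mod\<close> handles the high digit.\<close>

lemma class_affine_hom: "class_affine p \<in> hom wreath (BijGroup {0..int (p ^ 2) - 1})"
proof (rule homI)
  fix w assume "w \<in> carrier wreath"
  then show "class_affine p w \<in> carrier (BijGroup {0..int (p ^ 2) - 1})"
    using class_affine_Bij by (cases w) (auto simp: BijGroup_def)
next
  let ?S = "{0..int (p ^ 2) - 1}"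
  fix w w' assume "w \<in> carrier wreath" "w' \<in> carrier wreath"
  moreover obtain b v s a u t where w: "w = ((b, v), s)" "w' = ((a, u), t)"
    by (metis surj_pair)
  ultimately have g: "((b, v), s) \<in> carrier wreath" and f: "((a, u), t) \<in> carrier wreath"
    by simp_all
  note s = wreath_memD(1)[OF g] and t = wreath_memD(1)[OF f]
  have inv: "inv_into UNIV s i \<in> {1..p}" if "i \<in> {1..p}" for i
    using permutes_in_image[OF permutes_inv[OF s]] that by blast
  \<comment> \<open>The translation and multiplier parts of the product, with the reductions placed
    as in \<open>affine_comp_mod\<close>.\<close>
  let ?c = "\<lambda>i\<in>{1..p}. (b i + v i * a (inv_into UNIV s i) mod int p) mod int p"
  let ?w = "\<lambda>i\<in>{1..p}. v i * u (inv_into UNIV s i) mod int p"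
  have act: "perm_action R p s (a, u) = (permute_coords p s a, permute_coords p s u)"
    using f by (simp add: perm_action_def semidirect_product_def)
  have "permute_coords p s a \<in> carrier (add_power R p)"
    using wreath_memD(2)[OF f inv] by (auto simp: permute_coords_def res_carrier_eq)
  then have act': "units_action R p v (permute_coords p s a) =
      (\<lambda>i\<in>{1..p}. v i * a (inv_into UNIV s i) mod int p)"
    by (auto simp: units_action_def permute_coords_def res_mult_eq intro!: restrict_ext)
  have perm_u: "permute_coords p s u = (\<lambda>i\<in>{1..p}. u (inv_into UNIV s i))"
    by (simp only: permute_coords_def)
  have prod: "w \<otimes>\<^bsub>wreath\<^esub> w' = ((?c, ?w), s \<circ> t)"
    unfolding w
    by (simp add: semidirect_product_def act act' perm_u units_of_def
        res_add_eq res_mult_eq sym_group_mult cong: restrict_cong)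
  show "class_affine p (w \<otimes>\<^bsub>wreath\<^esub> w') =
      class_affine p w \<otimes>\<^bsub>BijGroup ?S\<^esub> class_affine p w'"
  proof (rule extensionalityI[where A = ?S])
    fix x assume x: "x \<in> ?S"
    let ?y = "class_affine p ((a, u), t) x" and ?j = "t (residue_index p x)"
    have j: "s ?j \<in> {1..p}"
      by (rule permutes_in_image[OF s, THEN iffD2, OF perm_residue_index_mem[OF f]])
    have "class_affine p w ?y = int (s ?j) - 1 + int p *
        ((b (s ?j) + v (s ?j) * ((a ?j + u ?j * (x div int p)) mod int p)) mod int p)"
      using class_affine_mem[OF f x] residue_index_class_affine[OF f x] class_affine_div[OF f x]
      by (simp add: class_affine_def[of p] w(1) Let_def)
    also have "\<dots> = class_affine p (w \<otimes>\<^bsub>wreath\<^esub> w') x"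
      using x j unfolding prod
      by (simp add: class_affine_def Let_def permutes_inverses(2)[OF s] affine_comp_mod)
    finally show "class_affine p (w \<otimes>\<^bsub>wreath\<^esub> w') x =
        (class_affine p w \<otimes>\<^bsub>BijGroup ?S\<^esub> class_affine p w') x"
      using x class_affine_Bij[OF g] class_affine_Bij[OF f]
      by (simp add: BijGroup_def compose_eq w)
  qed (simp_all add: class_affine_extensional BijGroup_def w class_affine_Bij[OF g]
      class_affine_Bij[OF f] del: of_nat_power)
qed

text \<open>All data can be read off from values: low digits give \<open>s\<close>, and on each
  class the high digits give an affine function of the argument's high digit.\<close>

lemma inj_on_class_affine: "inj_on (class_affine p) (carrier wreath)"
proof (rule inj_onI)
  fix w w' assume "w \<in> carrier wreath" "w' \<in> carrier wreath" "class_affine p w = class_affine p w'"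
  moreover obtain b v s a u t where w: "w = ((b, v), s)" "w' = ((a, u), t)"
    by (metis surj_pair)
  ultimately have g: "((b, v), s) \<in> carrier wreath" and f: "((a, u), t) \<in> carrier wreath"
    and eq: "class_affine p ((b, v), s) x = class_affine p ((a, u), t) x" for x
    by simp_all
  note s = wreath_memD(1)[OF g] and t = wreath_memD(1)[OF f]
  have digits: "s i = t i \<and> [b (s i) + v (s i) * r = a (s i) + u (s i) * r] (mod int p)"
    if i: "i \<in> {1..p}" and r: "r \<in> {0..<int p}" for i r
  proof -
    let ?x = "int i - 1 + int p * r"
    have x: "?x \<in> {0..int (p ^ 2) - 1}" using digits_mem[OF i r] .
    have idx: "residue_index p ?x = i" using residue_index_eq[OF i] .
    have div: "?x div int p = r" using i by simp
    have "s i = t i"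
      using residue_index_class_affine[OF g x] residue_index_class_affine[OF f x] idx eq by metis
    then show ?thesis
      using class_affine_div[OF g x] class_affine_div[OF f x] eq[of ?x]
      unfolding idx div cong_def by simp
  qed
  have "s i = t i" for i
    using digits[of i 0] p_gt_one s t by (cases "i \<in> {1..p}") (auto simp: permutes_not_in)
  then have "s = t" by blast
  have coords: "b j = a j \<and> v j = u j" if j: "j \<in> {1..p}" for j
  proof -
    obtain i where i: "i \<in> {1..p}" "s i = j"
      using permutes_image[OF s] j by (metis imageE)
    \<comment> \<open>An affine function is determined by its values at 0 and 1, both of which are
      digits because \<open>p > 1\<close>. The ranges of the parameters then turn congruences into
      equalities.\<close>
    have "[b j = a j] (mod int p)" and 1: "[b j + v j = a j + u j] (mod int p)"
      using digits[OF i(1), of 0, THEN conjunct2] digits[OF i(1), of 1, THEN conjunct2] p_gt_one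
      unfolding i(2) by simp_all
    then have ba: "b j = a j"
      using wreath_memD(2)[OF g j] wreath_memD(2)[OF f j] by (simp add: cong_def)
    with 1 have "[v j = u j] (mod int p)" by (simp add: cong_add_lcancel)
    then have "v j = u j"
      using wreath_memD(3)[OF g j] wreath_memD(3)[OF f j] by (simp add: cong_def)
    with ba show ?thesis by blast
  qed
  have "b \<in> {1..p} \<rightarrow>\<^sub>E {0..<int p}" "a \<in> {1..p} \<rightarrow>\<^sub>E {0..<int p}"
    "v \<in> {1..p} \<rightarrow>\<^sub>E {1..<int p}" "u \<in> {1..p} \<rightarrow>\<^sub>E {1..<int p}"
    using g f unfolding carrier_wreath by blast+
  then have "b = a" "v = u"
    using coords by (metis PiE_ext)+
  then show "w = w'" using \<open>s = t\<close> w by simp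
qed

section \<open>Class-affine maps are the polynomial permutations\<close>

text \<open>The exponent is the totient of \<open>p ^ 2\<close>, so Euler's theorem gives 1 when
  \<open>x\<close> is prime to \<open>p\<close>; being at least 2, it also makes the power of a
  multiple of \<open>p\<close> divisible by \<open>p ^ 2\<close>.\<close>

lemma power_indicator_mod_square:
  "x ^ (p * (p - 1)) mod int (p ^ 2) = (if int p dvd x then 0 else 1)"
proof (cases "int p dvd x")
  case True
  have "p * (p - 1) \<ge> 2"
    using p_gt_one mult_le_mono[of 2 p 1 "p - 1"] by simp
  then have "int p ^ 2 dvd x ^ (p * (p - 1))"
    using dvd_power_le[OF True] by blast
  then show ?thesis using True by simp
next
  case False
  interpret sq: residues "int (p ^ 2)" "residue_ring (int (p ^ 2))"
    by unfold_locales (rule p_square_gt_one)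
  have "coprime x (int (p ^ 2))"
    using False p_coprime_right_int by simp
  from sq.euler_theorem[OF this] have "[x ^ (p * (p - 1)) = 1] (mod int (p ^ 2))"
    using totient_prime_power[OF p_prime, of 2] by (simp del: of_nat_power)
  then show ?thesis using False p_square_gt_one by (simp add: cong_def del: of_nat_power)
qed

lemma class_affine_interpolation:
  assumes mem: "((a, u), s) \<in> carrier wreath"
  obtains q where
    "class_affine p ((a, u), s) = (\<lambda>x\<in>{0..int (p ^ 2) - 1}. poly q x mod int (p ^ 2))"
proof
  let ?n = "int (p ^ 2)"
  \<comment> \<open>\<open>?X i\<close> subtracts the representative \<open>int i - 1\<close> of the
    class with index \<open>i\<close>, so on that class its value is \<open>p * (x div p)\<close>,
    and the high digit enters without any division. In \<open>?q i\<close> the first factor is the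
    indicator of the class modulo \<open>p ^ 2\<close>, the second the prescribed affine function,
    with value \<open>?v i x\<close>.\<close>
  let ?X = "\<lambda>i. [:1 - int i, 1:]"
  let ?q = "\<lambda>i. (1 - ?X i ^ (p * (p - 1))) * ([:int (s i) - 1 + int p * a (s i):] + [:u (s i):] * ?X i)"
  let ?v = "\<lambda>i x. int (s i) - 1 + int p * a (s i) + u (s i) * (x - (int i - 1))"
  show "class_affine p ((a, u), s) = (\<lambda>x\<in>{0..?n - 1}. poly (\<Sum>i\<in>{1..p}. ?q i) x mod ?n)"
    unfolding class_affine_def prod.case
  proof (rule restrict_ext)
    fix x assume x: "x \<in> {0..?n - 1}"
    let ?k = "residue_index p x"
    have dvd: "int p dvd x - (int i - 1) \<longleftrightarrow> i = ?k" if i: "i \<in> {1..p}" for i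
    proof -
      have "int p dvd x - (int i - 1) \<longleftrightarrow> x mod int p = int i - 1"
        using i by (simp add: mod_eq_dvd_iff[symmetric])
      also have "\<dots> \<longleftrightarrow> int i = int ?k" unfolding int_residue_index by auto
      finally show ?thesis by simp
    qed
    have q: "[poly (?q i) x = (if i = ?k then ?v i x else 0)] (mod ?n)" if i: "i \<in> {1..p}" for i
    proof -
      have "[(x - (int i - 1)) ^ (p * (p - 1)) = (if i = ?k then 0 else 1)] (mod ?n)"
        using power_indicator_mod_square[of "x - (int i - 1)"] dvd[OF i] p_square_gt_one
        by (auto simp: cong_def simp del: of_nat_power)
      then have "[(1 - (x - (int i - 1)) ^ (p * (p - 1))) * ?v i x =
          (1 - (if i = ?k then 0 else 1)) * ?v i x] (mod ?n)"
        by (intro cong_mult cong_diff cong_refl)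
      then show ?thesis by (simp add: algebra_simps split: if_splits)
    qed
    have "[poly (\<Sum>i\<in>{1..p}. ?q i) x = (\<Sum>i\<in>{1..p}. if i = ?k then ?v i x else 0)] (mod ?n)"
      unfolding poly_sum by (intro cong_sum q)
    also have "(\<Sum>i\<in>{1..p}. if i = ?k then ?v i x else 0) = ?v ?k x"
      using residue_index_mem by (simp add: sum.delta del: atLeastAtMost_iff)
    also have "\<dots> = int (s ?k) - 1 + int p * (a (s ?k) + u (s ?k) * (x div int p))"
    proof -
      have "x - (int ?k - 1) = int p * (x div int p)"
        unfolding int_residue_index by (simp add: minus_mod_eq_mult_div)
      then show ?thesis by (simp only: algebra_simps)
    qed
    finally show "(let i = s ?k in int i - 1 + int p * ((a i + u i * (x div int p)) mod int p)) =
        poly (\<Sum>i\<in>{1..p}. ?q i) x mod ?n"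
      using mod_square_digits[OF perm_residue_index_mem[OF mem]] by (simp add: cong_def Let_def)
  qed
qed

text \<open>Surjectivity of \<open>F\<close> makes the induced map on classes a permutation,
  injectivity within a class makes the derivative a unit modulo \<open>p\<close>, and
  \<open>poly_add_mult_cong\<close> supplies the affine form.\<close>

lemma permutation_poly_is_class_affine:
  fixes q :: "int poly"
  defines "F \<equiv> \<lambda>x\<in>{0..int (p ^ 2) - 1}. poly q x mod int (p ^ 2)"
  assumes bij: "bij_betw F {0..int (p ^ 2) - 1} {0..int (p ^ 2) - 1}"
  shows "F \<in> class_affine p ` carrier wreath"
proof -
  let ?S = "{0..int (p ^ 2) - 1}" and ?n = "int (p ^ 2)"
  \<comment> \<open>The induced map on class indices, computed at the least representative;
    \<open>permutes\<close> demands the identity elsewhere.\<close>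
  define s where "s = (\<lambda>i. if i \<in> {1..p} then residue_index p (poly q (int i - 1)) else i)"
  \<comment> \<open>The choice of representative is immaterial, as integer polynomials respect
    congruence modulo \<open>p\<close>.\<close>
  have s_residue: "s (residue_index p x) = residue_index p (poly q x)" for x
  proof -
    have "[int (residue_index p x) - 1 = x] (mod int p)"
      unfolding int_residue_index by (simp add: cong_def)
    then have "[poly q (int (residue_index p x) - 1) = poly q x] (mod int p)"
      unfolding poly_altdef by (intro cong_sum cong_mult cong_pow cong_refl)
    then show ?thesis
      using residue_index_mem[of x] unfolding s_def by (simp add: residue_index_def cong_def)
  qed
  have s: "s permutes {1..p}"
  proof (rule bij_imp_permutes)
    have "{1..p} \<subseteq> s ` {1..p}"
    proof
      fix j assume j: "j \<in> {1..p}"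
      have "int j - 1 \<in> ?S"
        using digits_mem[OF j, of 0] p_gt_one by simp
      then obtain x where x: "x \<in> ?S" "F x = int j - 1"
        using bij by (metis bij_betw_imp_surj_on imageE)
      have "residue_index p (F x) = residue_index p (poly q x)"
        using x(1) unfolding F_def residue_index_def by (simp add: mod_mod_cancel power2_eq_square)
      also have "residue_index p (F x) = j"
        using residue_index_eq[OF j, of 0] x(2) by simp
      finally show "j \<in> s ` {1..p}"
        using s_residue[of x] residue_index_mem[of x] by (metis image_eqI)
    qed
    moreover have "s ` {1..p} \<subseteq> {1..p}"
      using residue_index_mem by (auto simp: s_def simp del: atLeastAtMost_iff)
    ultimately have "s ` {1..p} = {1..p}" by blast
    then show "bij_betw s {1..p} {1..p}"
      by (simp add: bij_betw_def eq_card_imp_inj_on)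
  qed (simp only: s_def if_False)
  \<comment> \<open>\<open>?r j\<close> represents the class that is sent to the class with index
    \<open>j\<close>. The parameters at \<open>j\<close> are the high digit of the value there,
    reduced because \<open>poly q\<close> is an unreduced integer, and the derivative there.\<close>
  let ?r = "\<lambda>j. int (inv_into UNIV s j) - 1"
  define a where "a = (\<lambda>j\<in>{1..p}. poly q (?r j) div int p mod int p)"
  define u where "u = (\<lambda>j\<in>{1..p}. poly (pderiv q) (?r j) mod int p)"
  \<comment> \<open>Otherwise the expansion at \<open>t = 1\<close> would give
    \<open>int i - 1\<close> and \<open>int i - 1 + int p\<close> the same image under
    \<open>F\<close>.\<close>
  have deriv: "\<not> int p dvd poly (pderiv q) (int i - 1)" if i: "i \<in> {1..p}" for i
  proof
    assume "int p dvd poly (pderiv q) (int i - 1)"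
    then have "?n dvd int p * 1 * poly (pderiv q) (int i - 1)"
      by (simp add: power2_eq_square)
    then have "[poly q (int i - 1) + int p * 1 * poly (pderiv q) (int i - 1) =
        poly q (int i - 1) + 0] (mod ?n)"
      by (intro cong_add cong_refl) (simp add: cong_0_iff)
    then have "[poly q (int i - 1 + int p * 1) = poly q (int i - 1)] (mod ?n)"
      using poly_add_mult_cong[of q "int i - 1" "int p" 1] cong_trans by fastforce
    moreover have S: "int i - 1 + int p * 1 \<in> ?S" "int i - 1 + int p * 0 \<in> ?S"
      using p_gt_one by (intro digits_mem[OF i]; simp)+
    ultimately have "F (int i - 1 + int p * 1) = F (int i - 1 + int p * 0)"
      unfolding F_def cong_def by simp
    then have "int i - 1 + int p * 1 = int i - 1 + int p * 0"
      using inj_onD[OF bij_betw_imp_inj_on[OF bij]] S by blast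
    then show False using p_gt_one by simp
  qed
  have inv: "inv_into UNIV s j \<in> {1..p}" if "j \<in> {1..p}" for j
    using permutes_in_image[OF permutes_inv[OF s]] that by blast
  have mem: "((a, u), s) \<in> carrier wreath"
  proof -
    have "u j \<in> {1..<int p}" if j: "j \<in> {1..p}" for j
    proof -
      have "u j = poly (pderiv q) (?r j) mod int p" using j by (simp add: u_def)
      moreover from this have "u j \<noteq> 0"
        using deriv[OF inv[OF j]] by (simp add: dvd_eq_mod_eq_0)
      moreover have "0 \<le> poly (pderiv q) (?r j) mod int p" "poly (pderiv q) (?r j) mod int p < int p"
        using p_gt_one by simp_all
      ultimately show ?thesis
        unfolding atLeastLessThan_iff by linarith
    qed
    then show ?thesis
      using s p_gt_one unfolding carrier_wreath by (auto simp: a_def u_def)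
  qed
  have "F = class_affine p ((a, u), s)"
    unfolding class_affine_def F_def prod.case
  proof (rule restrict_ext)
    fix x assume x: "x \<in> ?S"
    let ?i = "residue_index p x" and ?t = "x div int p"
    let ?A = "poly q (int ?i - 1)" and ?U = "poly (pderiv q) (int ?i - 1)"
    have r: "?r (s ?i) = int ?i - 1"
      by (simp add: permutes_inverses(2)[OF s])
    have si: "s ?i \<in> {1..p}" by (rule perm_residue_index_mem[OF mem])
    have "int (s ?i) - 1 = ?A mod int p"
      using residue_index_mem[of x] unfolding s_def by (simp add: int_residue_index)
    then have A: "?A = int (s ?i) - 1 + int p * (?A div int p)" by simp
    have "x = int ?i - 1 + int p * ?t"
      unfolding int_residue_index by simp
    then have "[poly q x = ?A + int p * ?t * ?U] (mod ?n)"
      using poly_add_mult_cong[of q "int ?i - 1" "int p" ?t] by simp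
    also have "?A + int p * ?t * ?U = int (s ?i) - 1 + int p * (?A div int p + ?U * ?t)"
      by (subst A) (simp add: algebra_simps)
    finally have "poly q x mod ?n =
        int (s ?i) - 1 + int p * ((?A div int p + ?U * ?t) mod int p)"
      using mod_square_digits[OF si] by (simp add: cong_def)
    also have "(?A div int p + ?U * ?t) mod int p = (a (s ?i) + u (s ?i) * ?t) mod int p"
      using si unfolding a_def u_def by (simp add: r affine_mod)
    finally show "poly q x mod ?n =
        (let i = s ?i in int i - 1 + int p * ((a i + u i * ?t) mod int p))"
      by (simp add: Let_def)
  qed
  with mem show ?thesis by blast
qed

text \<open>This exhibits the generators of \<open>Pgr\<close> as the image of a group homomorphism.
  One inclusion is the expansion of a permutation polynomial, the other interpolation combined with
  the bijectivity of class-affine maps.\<close>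

lemma permutation_polynomial_funs_eq:
  "{poly_fun (residue_ring (int (p ^ 2))) f | f.
      permutation_polynomial (residue_ring (int (p ^ 2))) f} = class_affine p ` carrier wreath"
proof -
  interpret sq: residues "int (p ^ 2)" "residue_ring (int (p ^ 2))"
    by unfold_locales (rule p_square_gt_one)
  show ?thesis
  proof (intro equalityI subsetI)
    fix F assume "F \<in> {poly_fun (residue_ring (int (p ^ 2))) f | f.
      permutation_polynomial (residue_ring (int (p ^ 2))) f}"
    then obtain f where f: "F = poly_fun (residue_ring (int (p ^ 2))) f"
      "permutation_polynomial (residue_ring (int (p ^ 2))) f" by blast
    then obtain q where "F = (\<lambda>x\<in>{0..int (p ^ 2) - 1}. poly q x mod int (p ^ 2))"
      by (metis permutation_polynomial_def sq.poly_fun_residue_ringE sq.res_carrier_eq)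
    then show "F \<in> class_affine p ` carrier wreath"
      using f permutation_poly_is_class_affine[of q]
      unfolding permutation_polynomial_def sq.res_carrier_eq by simp
  next
    fix F assume "F \<in> class_affine p ` carrier wreath"
    then obtain a u s where w: "((a, u), s) \<in> carrier wreath" "F = class_affine p ((a, u), s)"
      by auto
    obtain q where q: "F = (\<lambda>x\<in>{0..int (p ^ 2) - 1}. poly q x mod int (p ^ 2))"
      using class_affine_interpolation[OF w(1)] w(2) by metis
    obtain f where f: "f \<in> carrier (UP (residue_ring (int (p ^ 2))))"
      "poly_fun (residue_ring (int (p ^ 2))) f = F"
      using sq.poly_fun_residue_ring_of_int_poly[of q] unfolding q sq.res_carrier_eq by metis
    have "bij_betw F {0..int (p ^ 2) - 1} {0..int (p ^ 2) - 1}"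
      using class_affine_Bij[OF w(1)] w(2) by (simp add: Bij_def)
    then show "F \<in> {poly_fun (residue_ring (int (p ^ 2))) f | f.
      permutation_polynomial (residue_ring (int (p ^ 2))) f}"
      using f unfolding permutation_polynomial_def sq.res_carrier_eq by blast
  qed
qed

section \<open>The isomorphism onto the polypermutation group\<close>

lemma class_affine_iso: "class_affine p \<in> iso wreath (Pgr (residue_ring (int (p ^ 2))))"
proof -
  let ?B = "BijGroup {0..int (p ^ 2) - 1}"
  interpret group_hom wreath ?B "class_affine p"
    by (intro group_hom.intro group_hom_axioms.intro group_wreath group_BijGroup class_affine_hom)
  have "carrier (residue_ring (int (p ^ 2))) = {0..int (p ^ 2) - 1}"
    by (simp add: residue_ring_def)
  \<comment> \<open>The image of a homomorphism is a subgroup, hence generates only itself.\<close>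
  moreover have "generate ?B (class_affine p ` carrier wreath) = class_affine p ` carrier wreath"
    by (rule H.generateI[OF img_is_subgroup, symmetric]) auto
  ultimately have "Pgr (residue_ring (int (p ^ 2))) = ?B\<lparr>carrier := class_affine p ` carrier wreath\<rparr>"
    unfolding Pgr_def permutation_polynomial_funs_eq by simp
  then show ?thesis
    using class_affine_hom inj_on_class_affine
    by (auto simp: iso_def hom_def bij_betw_def)
qed

end

theorem theorem1p0p2:
  fixes p :: nat
  assumes "Factorial_Ring.prime p"
  shows "Pgr (residue_ring (int (p ^ 2))) \<cong>
    semidirect_product
      (semidirect_product
        (product_group {1..p} (\<lambda>_. add_monoid (residue_ring (int p))))
        (product_group {1..p} (\<lambda>_. units_of (residue_ring (int p))))
        (units_action (residue_ring (int p)) p))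
      (sym_group p)
      (perm_action (residue_ring (int p)) p)"
proof -
  interpret residues_prime p "residue_ring (int p)"
    using assms by unfold_locales
  show ?thesis
    by (rule is_isoI[OF group.iso_set_sym[OF group_wreath class_affine_iso]])
qed

end
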